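(* If $G$ is a connected graph of order at least $7$ with clique cover number $2$, then $ps(G)=3$.
   Context: All graphs are finite and simple (no loops or multiple edges), without isolated vertices and without isolated edges (an isolated edge is a connected component consisting of two vertices joined by an edge). The order of a graph is its number of vertices. For an edge labelling $\omega:E(X)\to\{1,2,\ldots,s\}$ of a graph $X$, the product degree of a vertex $v$ is $pd(v)=\prod_{e\ni v}\omega(e)$, the product over all edges $e$ incident with $v$. The labelling is product-irregular if $pd(u)\neq pd(v)$ for any two distinct vertices $u,v$ of $X$ (adjacent or not). The product irregularity strength $ps(X)$ is the smallest positive integer $s$ for which there exists a product-irregular labelling $\omega:E(X)\to\{1,2,\ldots,s\}$. The clique cover number of a graph is the minimum number of cliques (sets of pairwise adjacent vertices) that partition its vertex set. *)

theory Defs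
  imports Main "HOL-Library.Disjoint_Sets"
begin

text \<open>A finite simple graph is given by its vertex set \<open>V\<close> and its set \<open>E\<close> of edges, an edge being
  the two-element set of its ends; so a labelling of \<open>E\<close> is a function on unordered pairs.\<close>

definition finite_simple_graph :: "'a set \<Rightarrow> 'a set set \<Rightarrow> bool" where
  "finite_simple_graph V E \<longleftrightarrow> finite V \<and> (\<forall>e\<in>E. e \<subseteq> V \<and> card e = 2)"

definition no_isolated_vertex :: "'a set \<Rightarrow> 'a set set \<Rightarrow> bool" where
  "no_isolated_vertex V E \<longleftrightarrow> (\<forall>v\<in>V. \<exists>e\<in>E. v \<in> e)"

text \<open>An edge is isolated iff it meets no other edge, i.e. iff its two ends form a component.\<close>

definition no_isolated_edge :: "'a set set \<Rightarrow> bool" where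
  "no_isolated_edge E \<longleftrightarrow> (\<forall>e\<in>E. \<exists>f\<in>E. f \<noteq> e \<and> e \<inter> f \<noteq> {})"

definition connected_graph :: "'a set \<Rightarrow> 'a set set \<Rightarrow> bool" where
  "connected_graph V E \<longleftrightarrow> V \<noteq> {} \<and> (\<forall>u\<in>V. \<forall>v\<in>V. (u, v) \<in> {(x, y). {x, y} \<in> E}\<^sup>*)"

definition clique :: "'a set \<Rightarrow> 'a set set \<Rightarrow> 'a set \<Rightarrow> bool" where
  "clique V E C \<longleftrightarrow> C \<subseteq> V \<and> pairwise (\<lambda>u v. {u, v} \<in> E) C"

definition clique_cover_number :: "'a set \<Rightarrow> 'a set set \<Rightarrow> nat" where
  "clique_cover_number V E =
     (LEAST k. \<exists>P. partition_on V P \<and> (\<forall>C\<in>P. clique V E C) \<and> card P = k)"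

definition product_degree :: "'a set set \<Rightarrow> ('a set \<Rightarrow> nat) \<Rightarrow> 'a \<Rightarrow> nat" where
  "product_degree E \<omega> v = (\<Prod>e\<in>{e\<in>E. v \<in> e}. \<omega> e)"

definition product_irregular :: "'a set \<Rightarrow> 'a set set \<Rightarrow> ('a set \<Rightarrow> nat) \<Rightarrow> bool" where
  "product_irregular V E \<omega> \<longleftrightarrow>
     (\<forall>u\<in>V. \<forall>v\<in>V. u \<noteq> v \<longrightarrow> product_degree E \<omega> u \<noteq> product_degree E \<omega> v)"

definition product_irregularity_strength :: "'a set \<Rightarrow> 'a set set \<Rightarrow> nat" where
  "product_irregularity_strength V E =
     (LEAST s. 0 < s \<and> (\<exists>\<omega>. (\<forall>e\<in>E. \<omega> e \<in> {1..s}) \<and> product_irregular V E \<omega>))"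

end

theory Submission
  imports Defs "HOL-Combinatorics.Transposition"
begin

text \<open>
  With labels 1 and 2 only, \<open>pd\<close> is determined by the degree in the graph of edges labelled 2, and
  no simple graph on at least two vertices has pairwise distinct degrees. With label 3 available,
  keep the labels on two covering cliques of sizes \<open>a \<ge> b\<close> and on one edge between them, and give
  every other edge label 1. On vertices \<open>{..<m}\<close>, joining \<open>i\<close> and \<open>j\<close> when \<open>i + j \<ge> m\<close> produces a
  graph with exactly two vertices of equal degree, and changing the label of one edge at one of
  them tells them apart. In the big clique label this graph by 2 and its complement by 3, the
  modified edge getting 1; in the small clique label it by 2 and its complement by 1, the modified
  edge getting 3. Then almost all vertices of the big clique have a larger exponent of 3 than those
  of the small one. Only \<open>b \<le> 2\<close> and \<open>(a, b) \<in> {(4, 3), (4, 4), (5, 5)}\<close> need separate labellings.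
\<close>

section \<open>Unique factorisation and threshold labellings of complete graphs\<close>

lemma pow2_mult_pow3_eq_iff:
  "(2::nat) ^ a * 3 ^ b = 2 ^ c * 3 ^ d \<longleftrightarrow> a = c \<and> b = d"
proof
  assume eq: "(2::nat) ^ a * 3 ^ b = 2 ^ c * 3 ^ d"
  have *: "a \<le> c" if "(2::nat) ^ a * 3 ^ b = 2 ^ c * 3 ^ d" for a b c d :: nat
  proof -
    have "(2::nat) ^ a dvd 2 ^ c * 3 ^ d"
      by (metis dvd_triv_left that)
    moreover have "coprime ((2::nat) ^ a) (3 ^ d)"
      by simp
    ultimately have "(2::nat) ^ a dvd 2 ^ c"
      by (simp add: coprime_dvd_mult_left_iff)
    then show ?thesis
      by (simp add: dvd_power_iff_le)
  qed
  have "a = c"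
    using *[OF eq] *[OF eq[symmetric]] by simp
  with eq show "a = c \<and> b = d"
    by simp
qed simp

text \<open>The product degree of \<open>i\<close> in the complete graph on \<open>{..<m}\<close>,
  the model to which each covering clique is transported.\<close>

definition vertex_prod :: "nat \<Rightarrow> (nat set \<Rightarrow> nat) \<Rightarrow> nat \<Rightarrow> nat" where
  "vertex_prod m L i = (\<Prod>j\<in>{..<m} - {i}. L {i, j})"

text \<open>Put k = (m + 1) div 2. The vertices k - 1 and k are the two of equal degree in the
  threshold graph, and changing the label of {0, k} tells them apart. As 0 + k < m for m at least 3,
  this edge is taken from the complement, so no edge of label \<open>c\<close> is lost.\<close>

definition threshold_label :: "nat \<Rightarrow> nat \<Rightarrow> nat \<Rightarrow> nat \<Rightarrow> nat set \<Rightarrow> nat" where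
  "threshold_label c d x m e =
     (if e = {0, (m + 1) div 2} then x else if m \<le> \<Sum>e then c else d)"

text \<open>The exponent of the label \<open>c\<close> at vertex \<open>i\<close>; the subtraction accounts for the missing loop.\<close>

definition threshold_degree :: "nat \<Rightarrow> nat \<Rightarrow> nat" where
  "threshold_degree m i = (if 2 * i < m then i else i - 1)"

text \<open>The exponent of the label \<open>x\<close> at vertex \<open>i\<close>.\<close>

definition exceptional :: "nat \<Rightarrow> nat \<Rightarrow> nat" where
  "exceptional m i = (if i = 0 \<or> i = (m + 1) div 2 then 1 else 0)"

lemma vertex_prod_threshold_label:
  assumes "3 \<le> m" "i < m"
  shows "vertex_prod m (threshold_label c d x m) i =
           c ^ threshold_degree m i * d ^ (m - 1 - threshold_degree m i - exceptional m i) * x ^ exceptional m i"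
proof -
  define k where "k = (m + 1) div 2"
  \<comment> \<open>The neighbours \<open>J\<close> of \<open>i\<close> split into \<open>S\<close>
    (modified edge), \<open>C\<close> (threshold edges) and the rest. Removing \<open>i\<close> from
    \<open>C\<close> has an effect exactly when \<open>m \<le> 2 * i\<close>, which is the
    \<open>- 1\<close> in \<open>threshold_degree\<close>.\<close>
  define S where "S = (if i = 0 then {k} else if i = k then {0} else {})"
  define C where "C = {m - i..<m} - {i}"
  define J where "J = {..<m} - {i}"
  have k: "0 < k" "k < m"
    using assms by (auto simp: k_def)
  have S: "S \<subseteq> J" "card S = exceptional m i"
    using k by (auto simp: S_def J_def exceptional_def k_def)
  have C: "C \<subseteq> J" "card C = threshold_degree m i"
    using assms by (auto simp: C_def J_def threshold_degree_def card_Diff_singleton_if)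
  have SC: "S \<inter> C = {}"
    using k by (auto simp: S_def C_def)
  have fin: "finite J" "card J = m - 1"
    using assms by (auto simp: J_def)
  have finS: "finite S" "finite C"
    using fin S C finite_subset by blast+
  have lab: "threshold_label c d x m {i, j} = (if j \<in> S then x else if j \<in> C then c else d)" if "j \<in> J" for j
  proof -
    have "i \<noteq> j" "j < m"
      using that by (auto simp: J_def)
    then have "\<Sum>{i, j} = i + j"
      by simp
    moreover have "{i, j} = {0, k} \<longleftrightarrow> j \<in> S"
      using k by (auto simp: S_def doubleton_eq_iff)
    moreover have "m \<le> i + j \<longleftrightarrow> j \<in> C"
      using \<open>i \<noteq> j\<close> \<open>j < m\<close> by (auto simp: C_def)
    ultimately show ?thesis
      by (simp add: threshold_label_def k_def)
  qed
  have CJ: "C \<subseteq> J - S"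
    using C SC by auto
  have "vertex_prod m (threshold_label c d x m) i = (\<Prod>j\<in>J. if j \<in> S then x else if j \<in> C then c else d)"
    unfolding vertex_prod_def J_def[symmetric] using lab by (rule prod.cong[OF refl])
  also have "\<dots> = (\<Prod>j\<in>J - S - C. if j \<in> S then x else if j \<in> C then c else d) *
      (\<Prod>j\<in>C. if j \<in> S then x else if j \<in> C then c else d) *
      (\<Prod>j\<in>S. if j \<in> S then x else if j \<in> C then c else d)"
    using fin by (subst prod.subset_diff[OF S(1)], simp, subst prod.subset_diff[OF CJ]) simp_all
  also have "(\<Prod>j\<in>S. if j \<in> S then x else if j \<in> C then c else d) = (\<Prod>j\<in>S. x)"
    by (rule prod.cong) auto
  also have "(\<Prod>j\<in>C. if j \<in> S then x else if j \<in> C then c else d) = (\<Prod>j\<in>C. c)"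
    using SC by (intro prod.cong) auto
  also have "(\<Prod>j\<in>J - S - C. if j \<in> S then x else if j \<in> C then c else d) = (\<Prod>j\<in>J - S - C. d)"
    by (rule prod.cong) auto
  also have "card (J - S - C) = m - 1 - threshold_degree m i - exceptional m i"
  proof -
    have "card (J - S - C) = card (J - (C \<union> S))"
      by (rule arg_cong[of _ _ card]) auto
    also have "\<dots> = card J - (card C + card S)"
      using S C SC fin finS by (subst card_Diff_subset) (auto simp: card_Un_disjoint Int_commute)
    finally show ?thesis
      using S C fin by simp
  qed
  ultimately show ?thesis
    using S C by (simp add: mult_ac)
qed

text \<open>\<open>L\<close> and \<open>M\<close> label the two cliques; \<open>\<beta>\<close> is the label of the connecting edge, whose ends
  are \<open>p\<close> in the first and \<open>q\<close> in the second clique.\<close>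

definition separating ::
    "nat \<Rightarrow> nat \<Rightarrow> (nat set \<Rightarrow> nat) \<Rightarrow> (nat set \<Rightarrow> nat) \<Rightarrow> nat \<Rightarrow> nat \<Rightarrow> nat \<Rightarrow> bool" where
  "separating a b L M p q \<beta> \<longleftrightarrow>
     p < a \<and> q < b \<and> (\<forall>e. L e \<in> {1..3}) \<and> (\<forall>e. M e \<in> {1..3}) \<and> \<beta> \<in> {1..3} \<and>
     (let F = (\<lambda>i. vertex_prod a L i * (if i = p then \<beta> else 1));
          G = (\<lambda>i. vertex_prod b M i * (if i = q then \<beta> else 1))
      in inj_on F {..<a} \<and> inj_on G {..<b} \<and> F ` {..<a} \<inter> G ` {..<b} = {})"

lemma threshold_label_range:
  "threshold_label 2 3 1 m e \<in> {1..3}" "threshold_label 2 1 3 m e \<in> {1..3}"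
  by (auto simp: threshold_label_def)

text \<open>The degree is i below k and i - 1 from k on, so only k - 1 and k share a degree. Of
  these only k is exceptional: k is at least 2, hence k - 1 is not 0.\<close>

lemma threshold_degree_exceptional_inj:
  assumes "3 \<le> m" "threshold_degree m i = threshold_degree m j" "exceptional m i = exceptional m j"
  shows "i = j"
proof -
  define k where "k = (m + 1) div 2"
  have k: "2 * i < m \<longleftrightarrow> i < k" "2 \<le> k" for i
    using assms(1) by (auto simp: k_def)
  show ?thesis
    using assms(2,3) k(2) unfolding threshold_degree_def exceptional_def k(1) k_def[symmetric]
    by (simp split: if_splits)
qed

text \<open>This makes the exponent of 3 positive throughout the big clique. For m = 3 it would fail
  at vertex 2, which has threshold degree 1 and is exceptional.\<close>

lemma threshold_degree_bound:
  assumes "4 \<le> m" "i < m"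
  shows "threshold_degree m i + exceptional m i < m - 1"
  using assms by (auto simp: threshold_degree_def exceptional_def)

lemma inj_on_threshold_label_2_3_1:
  assumes "4 \<le> m"
  shows "inj_on (vertex_prod m (threshold_label 2 3 1 m)) {..<m}"
proof (rule inj_onI)
  fix i j assume ij: "i \<in> {..<m}" "j \<in> {..<m}"
    and eq: "vertex_prod m (threshold_label 2 3 1 m) i = vertex_prod m (threshold_label 2 3 1 m) j"
  define s where "s i = m - 1 - threshold_degree m i - exceptional m i" for i
  have s: "s i + (threshold_degree m i + exceptional m i) = m - 1" if "i < m" for i
    using that assms threshold_degree_bound[of m i] by (simp add: s_def)
  have "2 ^ threshold_degree m i * 3 ^ s i = (2::nat) ^ threshold_degree m j * 3 ^ s j"
    using eq ij assms by (simp add: vertex_prod_threshold_label s_def)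
  then have "threshold_degree m i = threshold_degree m j" "s i = s j"
    unfolding pow2_mult_pow3_eq_iff by blast+
  \<comment> \<open>The label 1 leaves no trace in the product, but the exponents of the three
    labels sum to m - 1, so those of 2 and 3 determine that of 1.\<close>
  moreover from this have "exceptional m i = exceptional m j"
    using s[of i] s[of j] ij by simp
  ultimately show "i = j"
    using assms threshold_degree_exceptional_inj[of m i j] by simp
qed

lemma inj_on_threshold_label_2_1_3:
  assumes "3 \<le> m"
  shows "inj_on (vertex_prod m (threshold_label 2 1 3 m)) {..<m}"
proof (rule inj_onI)
  fix i j assume ij: "i \<in> {..<m}" "j \<in> {..<m}"
    and eq: "vertex_prod m (threshold_label 2 1 3 m) i = vertex_prod m (threshold_label 2 1 3 m) j"
  have "threshold_degree m i = threshold_degree m j" "exceptional m i = exceptional m j"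
    using eq ij assms by (simp_all add: vertex_prod_threshold_label pow2_mult_pow3_eq_iff)
  then show "i = j"
    using assms threshold_degree_exceptional_inj[of m i j] by simp
qed

text \<open>A common product would contain at least one factor 3 because of the big clique and at
  most one because of the small one. So \<open>i\<close> has threshold degree at least a - 3, while
  \<open>j\<close> is an end of the modified edge and has degree at most (b + 1) div 2 - 1. For
  these sizes this happens only if a = b = 5.\<close>

lemma threshold_label_2_3_1_neq_threshold_label_2_1_3:
  assumes "3 \<le> b" "b \<le> a" "5 \<le> a" "(a, b) \<noteq> (5, 5)" "i < a" "j < b"
  shows "vertex_prod a (threshold_label 2 3 1 a) i \<noteq> vertex_prod b (threshold_label 2 1 3 b) j"
proof
  assume "vertex_prod a (threshold_label 2 3 1 a) i = vertex_prod b (threshold_label 2 1 3 b) j"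
  then have "2 ^ threshold_degree a i * 3 ^ (a - 1 - threshold_degree a i - exceptional a i) =
      (2::nat) ^ threshold_degree b j * 3 ^ exceptional b j"
    using assms by (simp add: vertex_prod_threshold_label)
  then have eq: "threshold_degree a i = threshold_degree b j" "a - 1 - threshold_degree a i - exceptional a i = exceptional b j"
    unfolding pow2_mult_pow3_eq_iff by blast+
  have "threshold_degree a i + exceptional a i < a - 1"
    using threshold_degree_bound[of a i] assms by simp
  moreover have "exceptional a i \<le> 1" "exceptional b j \<le> 1"
    by (simp_all add: exceptional_def)
  ultimately have 1: "exceptional b j = 1" "a \<le> threshold_degree b j + 3"
    using eq by linarith+
  from 1(1) have "j = 0 \<or> j = (b + 1) div 2"
    unfolding exceptional_def by (metis zero_neq_one)
  moreover have "\<not> 2 * ((b + 1) div 2) < b"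
    by linarith
  ultimately have "threshold_degree b j = 0 \<or> threshold_degree b j = (b + 1) div 2 - 1"
    unfolding threshold_degree_def by presburger
  then have "a \<le> (b + 1) div 2 + 2"
    using 1(2) assms(1,3) by linarith
  moreover have "2 * ((b + 1) div 2) \<le> b + 1"
    by linarith
  ultimately have "a = 5 \<and> b = 5"
    using assms(2,3) by linarith
  with assms(4) show False
    by simp
qed

text \<open>A connecting label 1 changes no product, so the ends 0 and 0 are an arbitrary
  choice.\<close>

lemma separating_generic:
  assumes "3 \<le> b" "b \<le> a" "5 \<le> a" "(a, b) \<noteq> (5, 5)"
  shows "separating a b (threshold_label 2 3 1 a) (threshold_label 2 1 3 b) 0 0 1"
proof -
  have "vertex_prod a (threshold_label 2 3 1 a) ` {..<a} \<inter> vertex_prod b (threshold_label 2 1 3 b) ` {..<b} = {}"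
    using threshold_label_2_3_1_neq_threshold_label_2_1_3[OF assms] by force
  moreover have "threshold_label 2 3 1 a e \<in> {1..3}" "threshold_label 2 1 3 b e \<in> {1..3}" for e
    by (rule threshold_label_range)+
  ultimately show ?thesis
    using assms inj_on_threshold_label_2_3_1[of a] inj_on_threshold_label_2_1_3[of b]
    by (simp add: separating_def Let_def del: One_nat_def)
qed

text \<open>The single vertex has product 1, while 3 divides every product in the big
  clique.\<close>

lemma separating_1:
  assumes "6 \<le> a"
  shows "separating a 1 (threshold_label 2 3 1 a) (\<lambda>_. 1) 0 0 1"
proof -
  have "vertex_prod a (threshold_label 2 3 1 a) i \<noteq> 1" if "i < a" for i
  proof -
    have "0 < a - 1 - threshold_degree a i - exceptional a i"
      using threshold_degree_bound[of a i] assms that by linarith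
    then show ?thesis
      using that assms
        pow2_mult_pow3_eq_iff[of "threshold_degree a i" "a - 1 - threshold_degree a i - exceptional a i" 0 0]
      by (simp add: vertex_prod_threshold_label)
  qed
  then have "1 \<notin> vertex_prod a (threshold_label 2 3 1 a) ` {..<a}"
    by force
  moreover have "threshold_label 2 3 1 a e \<in> {1..3}" for e
    by (rule threshold_label_range)
  moreover have "vertex_prod 1 (\<lambda>_. 1) 0 = 1"
    unfolding vertex_prod_def by (rule prod.neutral) simp
  moreover have "{..<1} = {0::nat}"
    by auto
  ultimately show ?thesis
    using assms inj_on_threshold_label_2_3_1[of a]
    by (simp add: separating_def Let_def del: One_nat_def)
qed

text \<open>The small clique gets the products 2 and 1, and 3 divides every product in the big one.
  The connecting edge is attached at vertex 1 because that vertex is not exceptional: its total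
  exponent then exceeds all others.\<close>

lemma separating_2:
  assumes "5 \<le> a"
  shows "separating a 2 (threshold_label 2 3 1 a) (\<lambda>_. 1) 1 0 2"
proof -
  define F where "F i = vertex_prod a (threshold_label 2 3 1 a) i * (if i = 1 then 2 else 1)" for i
  define r where "r i = threshold_degree a i + (if i = 1 then 1 else 0)" for i
  define s where "s i = a - 1 - threshold_degree a i - exceptional a i" for i
  have F: "F i = 2 ^ r i * 3 ^ s i" if "i < a" for i
    using that assms by (simp add: F_def vertex_prod_threshold_label r_def s_def)
  have s: "s i + threshold_degree a i + exceptional a i = a - 1" "0 < s i" if "i < a" for i
    using that assms threshold_degree_bound[of a i] by (simp_all add: s_def)
  have exc_le: "exceptional a i \<le> 1" "exceptional a 1 = 0" for i
    using assms by (auto simp: exceptional_def)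
  have "inj_on F {..<a}"
  proof (rule inj_onI)
    fix i j assume ij: "i \<in> {..<a}" "j \<in> {..<a}" and "F i = F j"
    then have eq: "r i = r j" "s i = s j"
      by (simp_all add: F pow2_mult_pow3_eq_iff)
    show "i = j"
    proof (cases "i = 1 \<longleftrightarrow> j = 1")
      case True
      then have "threshold_degree a i = threshold_degree a j"
        using eq by (auto simp: r_def)
      moreover from this have "exceptional a i = exceptional a j"
        using s(1)[of i] s(1)[of j] eq ij by simp
      ultimately show ?thesis
        using assms threshold_degree_exceptional_inj[of a i j] by simp
    next
      \<comment> \<open>Vertex 1 has r + s = a, every other vertex at most a - 1.\<close>
      case False
      then show ?thesis
        using s(1)[of i] s(1)[of j] eq ij exc_le(1)[of i] exc_le(1)[of j] exc_le(2)
        by (auto simp: r_def)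
    qed
  qed
  moreover have "F i \<noteq> 1 \<and> F i \<noteq> 2" if "i < a" for i
    using s(2)[OF that] pow2_mult_pow3_eq_iff[of "r i" "s i" 0 0]
      pow2_mult_pow3_eq_iff[of "r i" "s i" 1 0]
    by (simp add: F[OF that])
  then have "F ` {..<a} \<inter> {1, 2} = {}"
    by force
  moreover have "threshold_label 2 3 1 a e \<in> {1..3}" for e
    by (rule threshold_label_range)
  moreover have "vertex_prod 2 (\<lambda>_. 1) i = 1" for i
    unfolding vertex_prod_def by (rule prod.neutral) simp
  moreover have "{..<2} = {0, 1::nat}"
    by auto
  ultimately show ?thesis
    using assms
    by (simp add: separating_def Let_def F_def[abs_def] insert_commute del: One_nat_def)
qed

section \<open>Explicit labellings for small cliques\<close>

definition edge_label :: "'b set \<Rightarrow> 'b set \<Rightarrow> 'b \<Rightarrow> nat" where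
  "edge_label S T e = (if e \<in> S then 2 else if e \<in> T then 3 else 1)"

lemma edge_label_range: "edge_label S T e \<in> {1..3}"
  by (auto simp: edge_label_def)

lemma lessThan_small: "{..<3} = {0, 1, 2::nat}" "{..<4} = {0, 1, 2, 3::nat}"
  "{..<5} = {0, 1, 2, 3, 4::nat}"
  by auto

text \<open>For a = 4 and b = 3 or 4 the generic labels clash: vertex 2 has product 6 in both
  cliques. Here the products are 8, 3, 6, 18 against 4, 1, 2.\<close>

lemma separating_4_3:
  "separating 4 3 (edge_label {{0, 2}, {0, 3}} {{1, 3}, {2, 3}}) (edge_label {{0, 2}} {}) 0 0 2"
  unfolding separating_def
  by (intro conjI allI edge_label_range threshold_label_range)
    (simp_all add: Let_def vertex_prod_def lessThan_small edge_label_def doubleton_eq_iff insert_Diff_if)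

text \<open>The products are 4, 1, 3, 6 against 12, 9, 18, 27.\<close>

lemma separating_4_4:
  "separating 4 4 (edge_label {{0, 3}} {{2, 3}}) (edge_label {{0, 2}} {{0, 3}, {1, 2}, {1, 3}, {2, 3}}) 0 0 2"
  unfolding separating_def
  by (intro conjI allI edge_label_range threshold_label_range)
    (simp_all add: Let_def vertex_prod_def lessThan_small edge_label_def doubleton_eq_iff insert_Diff_if)

text \<open>The generic labels give vertex 3 the product 12 in both cliques, so the first labelling
  is replaced. The products are 1, 6, 18, 9, 27 against 3, 2, 4, 12, 8.\<close>

lemma separating_5_5:
  "separating 5 5 (edge_label {{1, 2}} {{1, 4}, {2, 3}, {2, 4}, {3, 4}}) (threshold_label 2 1 3 5) 0 0 1"
  unfolding separating_def
  by (intro conjI allI edge_label_range threshold_label_range)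
    (simp_all add: Let_def vertex_prod_def lessThan_small edge_label_def threshold_label_def
      doubleton_eq_iff insert_Diff_if)

lemma exists_separating:
  assumes "1 \<le> b" "b \<le> a" "7 \<le> a + b"
  shows "\<exists>L M p q \<beta>. separating a b L M p q \<beta>"
proof -
  consider "b = 1" | "b = 2" | "a = 4" "b = 3" | "a = 4" "b = 4" | "a = 5" "b = 5"
    | "3 \<le> b" "5 \<le> a" "(a, b) \<noteq> (5, 5)"
  proof -
    \<comment> \<open>If b is at least 3 and a is below 5, the bound on a + b leaves only (4, 3) and
      (4, 4).\<close>
    have "b = 1 \<or> b = 2 \<or> a = 4 \<and> b = 3 \<or> a = 4 \<and> b = 4 \<or> a = 5 \<and> b = 5 \<or>
        3 \<le> b \<and> 5 \<le> a \<and> \<not> (a = 5 \<and> b = 5)"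
      using assms by linarith
    then show ?thesis
      using that by auto
  qed
  then show ?thesis
  proof cases
    case 1
    then have "separating a b (threshold_label 2 3 1 a) (\<lambda>_. 1) 0 0 1"
      using separating_1[of a] assms by simp
    then show ?thesis by blast
  next
    case 2
    then have "separating a b (threshold_label 2 3 1 a) (\<lambda>_. 1) 1 0 2"
      using separating_2[of a] assms by simp
    then show ?thesis by blast
  next
    case 3
    then show ?thesis using separating_4_3 by blast
  next
    case 4
    then show ?thesis using separating_4_4 by blast
  next
    case 5
    then show ?thesis using separating_5_5 by blast
  next
    case 6
    then show ?thesis using separating_generic assms by blast
  qed
qed

section \<open>Product degrees in graphs, the lower bound and the transfer from cliques\<close>

lemma product_degree_eq_prod_vertices:
  assumes "finite_simple_graph V E" "v \<in> V"
  shows "product_degree E \<omega> v = (\<Prod>u\<in>V - {v}. if {v, u} \<in> E then \<omega> {v, u} else 1)"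
proof -
  have fin: "finite V" and E: "\<And>e. e \<in> E \<Longrightarrow> e \<subseteq> V \<and> card e = 2"
    using assms by (auto simp: finite_simple_graph_def)
  have "{e \<in> E. v \<in> e} = (\<lambda>u. {v, u}) ` {u \<in> V - {v}. {v, u} \<in> E}" (is "?L = ?R")
  proof (intro equalityI subsetI)
    fix e assume e: "e \<in> ?L"
    then obtain x y where "e = {x, y}" "x \<noteq> y"
      using E by (metis (no_types, lifting) card_2_iff mem_Collect_eq)
    with e obtain u where "e = {v, u}" "u \<noteq> v"
      by auto
    with e E show "e \<in> ?R"
      by force
  qed auto
  moreover have "inj_on (\<lambda>u. {v, u}) {u \<in> V - {v}. {v, u} \<in> E}"
    by (auto simp: inj_on_def doubleton_eq_iff)
  ultimately have "product_degree E \<omega> v = (\<Prod>u\<in>{u \<in> V - {v}. {v, u} \<in> E}. \<omega> {v, u})"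
    by (simp add: product_degree_def prod.reindex)
  \<comment> \<open>Non-neighbours contribute the factor 1, so that the product can later be split
    along the two cliques.\<close>
  also have "\<dots> = (\<Prod>u\<in>V - {v}. if {v, u} \<in> E then \<omega> {v, u} else 1)"
    using fin by (intro prod.inter_filter) simp
  finally show ?thesis .
qed

text \<open>If the n degrees in the graph of edges labelled 2 were distinct, they would fill {0,
  ..., n - 1}. But a vertex of degree n - 1 is adjacent to all others, including the one of degree
  0.\<close>

lemma label_bound_ge_3:
  assumes G: "finite_simple_graph V E" and "2 \<le> card V"
    and lab: "\<forall>e\<in>E. \<omega> e \<in> {1..s}" and irr: "product_irregular V E \<omega>"
  shows "3 \<le> s"
proof (rule ccontr)
  assume "\<not> 3 \<le> s"
  then have lab2: "\<omega> e = 1 \<or> \<omega> e = 2" if "e \<in> E" for e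
    using lab that by fastforce
  define n where "n = card V"
  have fin: "finite V"
    using G by (simp add: finite_simple_graph_def)
  define N where "N v = {u \<in> V - {v}. {v, u} \<in> E \<and> \<omega> {v, u} = 2}" for v
  have pd: "product_degree E \<omega> v = 2 ^ card (N v)" if "v \<in> V" for v
  proof -
    have "product_degree E \<omega> v = (\<Prod>u\<in>V - {v}. if {v, u} \<in> E \<and> \<omega> {v, u} = 2 then 2 else 1)"
      unfolding product_degree_eq_prod_vertices[OF G that] using lab2 by (intro prod.cong) auto
    also have "\<dots> = (\<Prod>u\<in>N v. 2)"
      unfolding N_def using fin by (intro prod.inter_filter[symmetric]) simp
    finally show ?thesis
      by simp
  qed
  have inj: "inj_on (\<lambda>v. card (N v)) V"
    using irr pd unfolding product_irregular_def inj_on_def by metis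
  have "card (N v) < n" if "v \<in> V" for v
    unfolding n_def using that fin by (intro psubset_card_mono) (auto simp: N_def)
  then have "(\<lambda>v. card (N v)) ` V = {..<n}"
    using inj by (intro card_subset_eq) (auto simp: card_image n_def)
  moreover have "0 \<in> {..<n}" "n - 1 \<in> {..<n}"
    using assms(2) by (auto simp: n_def)
  ultimately obtain u v where uv: "u \<in> V" "v \<in> V" "card (N u) = 0" "card (N v) = n - 1"
    by (metis (no_types, lifting) imageE)
  have "u \<noteq> v"
    using uv assms(2) by (auto simp: n_def)
  have "N v = V - {v}"
    using uv fin by (intro card_subset_eq) (auto simp: N_def n_def)
  with uv \<open>u \<noteq> v\<close> have "v \<in> N u"
    by (auto simp: N_def insert_commute)
  moreover have "finite (N u)"
    using fin by (simp add: N_def)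
  ultimately show False
    using uv by auto
qed

text \<open>With label 1 on all other crossing edges, each product degree is a product inside one
  clique, with an extra factor \<beta> at \<open>x\<close> and \<open>y\<close> only. Bijections
  sending \<open>x\<close> to \<open>p\<close> and \<open>y\<close> to \<open>q\<close> then carry
  the separation over.\<close>

lemma two_cliques_labelling:
  assumes G: "finite_simple_graph V E" and V: "V = A \<union> B" "A \<inter> B = {}"
    and cl: "clique V E A" "clique V E B"
    and xy: "x \<in> A" "y \<in> B" "{x, y} \<in> E"
    and sep: "separating (card A) (card B) L M p q \<beta>"
  shows "\<exists>\<omega>. (\<forall>e\<in>E. \<omega> e \<in> {1..3}) \<and> product_irregular V E \<omega>"
proof -
  have fin: "finite A" "finite B"
    using G V by (auto simp: finite_simple_graph_def)
  have pq: "p < card A" "q < card B"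
    using sep by (auto simp: separating_def)
  have yx: "{y, x} \<in> E"
    using xy by (simp add: insert_commute)
  \<comment> \<open>Take any enumeration of \<open>S\<close>, followed by the transposition of
    \<open>g z\<close> and \<open>r\<close>.\<close>
  have ex: "\<exists>f. bij_betw f S {..<card S} \<and> f z = r" if "finite S" "z \<in> S" "r < card S"
    for S :: "'a set" and z r
  proof -
    obtain g where g: "bij_betw g S {..<card S}"
      using ex_bij_betw_finite_nat[OF \<open>finite S\<close>] by (auto simp: atLeast0LessThan)
    have gz: "g z \<in> {..<card S}"
      using g that by (meson bij_betwE)
    have "bij_betw (Transposition.transpose (g z) r) {..<card S} {..<card S}"
      using gz that by (intro bij_betw_transpose_iff) auto
    then show ?thesis
      using g bij_betw_trans by force
  qed
  obtain f where f: "bij_betw f A {..<card A}" "f x = p"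
    using ex fin xy pq by meson
  obtain g where g: "bij_betw g B {..<card B}" "g y = q"
    using ex fin xy pq by meson
  define F where "F i = vertex_prod (card A) L i * (if i = p then \<beta> else 1)" for i
  define H where "H i = vertex_prod (card B) M i * (if i = q then \<beta> else 1)" for i
  define \<omega> where "\<omega> e = (if e \<subseteq> A then L (f ` e) else if e \<subseteq> B then M (g ` e)
      else if e = {x, y} then \<beta> else 1)" for e
  have part: "(\<Prod>u\<in>S - {v}. K {h v, h u}) = vertex_prod (card S) K (h v)"
    if "bij_betw h S {..<card S}" "v \<in> S" for h S K and v :: 'a
  proof -
    have "bij_betw h (S - {v}) ({..<card S} - {h v})"
      using that bij_betw_DiffI[of h S _ "{v}" "{h v}"] by (auto simp: bij_betw_def)
    then show ?thesis
      unfolding vertex_prod_def by (rule prod.reindex_bij_betw)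
  qed
  have pdA: "product_degree E \<omega> v = F (f v)" if v: "v \<in> A" for v
  proof -
    have "product_degree E \<omega> v = (\<Prod>u\<in>(A - {v}) \<union> B. if {v, u} \<in> E then \<omega> {v, u} else 1)"
      using product_degree_eq_prod_vertices[OF G, of v] v V by (auto intro!: prod.cong)
    also have "\<dots> = (\<Prod>u\<in>A - {v}. if {v, u} \<in> E then \<omega> {v, u} else 1) *
        (\<Prod>u\<in>B. if {v, u} \<in> E then \<omega> {v, u} else 1)"
      using fin V by (intro prod.union_disjoint) auto
    also have "(\<Prod>u\<in>A - {v}. if {v, u} \<in> E then \<omega> {v, u} else 1) = (\<Prod>u\<in>A - {v}. L {f v, f u})"
      using v cl(1) by (intro prod.cong) (auto simp: \<omega>_def clique_def pairwise_def)
    also have "\<dots> = vertex_prod (card A) L (f v)"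
      using part f v by blast
    \<comment> \<open>Among the edges from \<open>v\<close> to \<open>B\<close>, only {x, y} can
      have a label other than 1.\<close>
    also have "(\<Prod>u\<in>B. if {v, u} \<in> E then \<omega> {v, u} else 1) =
        (\<Prod>u\<in>B. if u = y then if v = x then \<beta> else 1 else 1)"
      using v V xy by (intro prod.cong) (auto simp: \<omega>_def doubleton_eq_iff)
    also have "\<dots> = (if v = x then \<beta> else 1)"
      using fin xy by (subst prod.delta) auto
    also have "v = x \<longleftrightarrow> f v = p"
      using f v xy by (auto simp: bij_betw_def inj_on_def)
    finally show ?thesis
      by (simp add: F_def)
  qed
  have pdB: "product_degree E \<omega> v = H (g v)" if v: "v \<in> B" for v
  proof -
    have "product_degree E \<omega> v = (\<Prod>u\<in>(B - {v}) \<union> A. if {v, u} \<in> E then \<omega> {v, u} else 1)"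
      using product_degree_eq_prod_vertices[OF G, of v] v V by (auto intro!: prod.cong)
    also have "\<dots> = (\<Prod>u\<in>B - {v}. if {v, u} \<in> E then \<omega> {v, u} else 1) *
        (\<Prod>u\<in>A. if {v, u} \<in> E then \<omega> {v, u} else 1)"
      using fin V by (intro prod.union_disjoint) auto
    also have "(\<Prod>u\<in>B - {v}. if {v, u} \<in> E then \<omega> {v, u} else 1) = (\<Prod>u\<in>B - {v}. M {g v, g u})"
      using v V cl(2) by (intro prod.cong) (auto simp: \<omega>_def clique_def pairwise_def)
    also have "\<dots> = vertex_prod (card B) M (g v)"
      using part g v by blast
    also have "(\<Prod>u\<in>A. if {v, u} \<in> E then \<omega> {v, u} else 1) =
        (\<Prod>u\<in>A. if u = x then if v = y then \<beta> else 1 else 1)"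
      using v V xy yx by (intro prod.cong) (auto simp: \<omega>_def doubleton_eq_iff)
    also have "\<dots> = (if v = y then \<beta> else 1)"
      using fin xy by (subst prod.delta) auto
    also have "v = y \<longleftrightarrow> g v = q"
      using g v xy by (auto simp: bij_betw_def inj_on_def)
    finally show ?thesis
      by (simp add: H_def)
  qed
  have injF: "inj_on F {..<card A}" and injH: "inj_on H {..<card B}"
    and FH: "F ` {..<card A} \<inter> H ` {..<card B} = {}"
    using sep by (simp_all add: separating_def Let_def F_def[abs_def] H_def[abs_def])
  have "inj_on (F \<circ> f) A" "inj_on (H \<circ> g) B"
    using comp_inj_on f g injF injH by (metis bij_betw_def)+
  moreover have "F (f u) \<noteq> H (g v)" if "u \<in> A" "v \<in> B" for u v
    using FH that f g bij_betwE by (metis disjoint_iff image_eqI)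
  ultimately have "product_degree E \<omega> u \<noteq> product_degree E \<omega> v"
    if "u \<in> V" "v \<in> V" "u \<noteq> v" for u v
    using that pdA pdB unfolding V(1) inj_on_def comp_def by (metis UnE)
  then have "product_irregular V E \<omega>"
    by (simp add: product_irregular_def)
  moreover have "\<omega> e \<in> {1..3}" for e
    using sep by (auto simp: \<omega>_def separating_def)
  ultimately show ?thesis
    by blast
qed

section \<open>Two covering cliques of a connected graph\<close>

text \<open>The partition into singletons shows that \<open>LEAST\<close> ranges over a nonempty
  set, so the minimum is attained.\<close>

lemma clique_cover_number_witness:
  assumes "finite_simple_graph V E"
  shows "\<exists>P. partition_on V P \<and> (\<forall>C\<in>P. clique V E C) \<and> card P = clique_cover_number V E"
  unfolding clique_cover_number_def
proof (rule LeastI_ex)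
  have "partition_on V ((\<lambda>v. {v}) ` V)"
    by (auto simp: partition_on_def disjoint_def)
  moreover have "\<forall>C\<in>(\<lambda>v. {v}) ` V. clique V E C"
    by (auto simp: clique_def)
  ultimately show "\<exists>k P. partition_on V P \<and> (\<forall>C\<in>P. clique V E C) \<and> card P = k"
    by blast
qed

text \<open>Without a crossing edge, every walk that starts in \<open>A\<close> stays in
  \<open>A\<close>.\<close>

lemma connected_graph_crossing_edge:
  assumes "connected_graph V E" "V = A \<union> B" "A \<noteq> {}" "B \<noteq> {}" "A \<inter> B = {}"
    and G: "finite_simple_graph V E"
  shows "\<exists>x\<in>A. \<exists>y\<in>B. {x, y} \<in> E"
proof (rule ccontr)
  assume none: "\<not> ?thesis"
  obtain a b where ab: "a \<in> A" "b \<in> B"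
    using assms by blast
  have "(a, b) \<in> {(x, y). {x, y} \<in> E}\<^sup>*"
    using assms ab by (auto simp: connected_graph_def)
  then have "b \<in> A"
  proof (induction rule: rtrancl_induct)
    case (step y z)
    then have "{y, z} \<in> E"
      by simp
    moreover from this have "z \<in> A \<union> B"
      using G assms(2) by (auto simp: finite_simple_graph_def)
    ultimately show ?case
      using none step by blast
  qed (use ab in simp)
  with ab assms show False
    by blast
qed

theorem corollary3p5:
  fixes V :: "'a set" and E :: "'a set set"
  assumes "finite_simple_graph V E"
    and "no_isolated_vertex V E"
    and "no_isolated_edge E"
    and "connected_graph V E"
    and "card V \<ge> 7"
    and "clique_cover_number V E = 2"
  shows "product_irregularity_strength V E = 3"
proof -
  obtain P where P: "partition_on V P" "\<forall>C\<in>P. clique V E C" "card P = 2"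
    using clique_cover_number_witness[OF assms(1)] assms(6) by auto
  \<comment> \<open>The two cliques are named so that \<open>A\<close> is at least as large as
    \<open>B\<close>.\<close>
  obtain A B where AB: "P = {A, B}" "A \<noteq> B" "card B \<le> card A"
    using P(3) by (metis card_2_iff insert_commute linear)
  have V: "V = A \<union> B" "A \<inter> B = {}" "A \<noteq> {}" "B \<noteq> {}"
    using P(1) AB by (auto simp: partition_on_def disjoint_def)
  obtain x y where xy: "x \<in> A" "y \<in> B" "{x, y} \<in> E"
    using connected_graph_crossing_edge[OF assms(4)] V assms(1) by blast
  have "finite A" "finite B"
    using assms(1) V by (auto simp: finite_simple_graph_def)
  then have "1 \<le> card B" "7 \<le> card A + card B"
    using V assms(5) by (auto simp: card_Un_disjoint card_gt_0_iff Suc_le_eq)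
  then obtain L M p q \<beta> where "separating (card A) (card B) L M p q \<beta>"
    using exists_separating AB(3) by blast
  then have "\<exists>\<omega>. (\<forall>e\<in>E. \<omega> e \<in> {1..3}) \<and> product_irregular V E \<omega>"
    using two_cliques_labelling[OF assms(1) V(1,2)] P(2) AB(1) xy by blast
  \<comment> \<open>The labelling found shows that 3 is admissible; every admissible
    \<open>s\<close> is at least 3.\<close>
  then show ?thesis
    unfolding product_irregularity_strength_def
    using label_bound_ge_3[OF assms(1)] assms(5) by (intro Least_equality) auto
qed

end
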